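(* Let $n_1 < n_2 < n_3$ be positive integers with $\gcd(n_1,n_2,n_3)=1$, let $S = \langle n_1, n_2, n_3\rangle$ be the numerical semigroup they generate, and let $t$ be the trade element of $S$. Then there is a rational-valued periodic function $c_0$ with period $t$ such that for each $n \in S$, $$\nu(n) = \tfrac{1}{t}\,n + c_0(n),$$ where $\nu(n)$ is the mode frequency of $n$. Moreover, for all $n \in S$, the sets of mode factorization lengths satisfy $$\gamma(n+t) = \gamma(n) + t/n_2 = \{m + t/n_2 : m \in \gamma(n)\}.$$
   Context: $\mathbb{N}$ denotes the nonnegative integers. $S = \langle n_1,n_2,n_3\rangle = \{a_1n_1+a_2n_2+a_3n_3 : a_1,a_2,a_3\in\mathbb{N}\}$. It is not assumed that $n_1,n_2,n_3$ minimally generate $S$. For $n\in S$, a factorization of $n$ is a triple $a=(a_1,a_2,a_3)\in\mathbb{N}^3$ with $n = a_1n_1+a_2n_2+a_3n_3$; its length is $|a| = a_1+a_2+a_3$. The length multiset of $n$ is the multiset of lengths of all factorizations of $n$ (each factorization contributes one entry). The mode frequency $\nu(n)$ is the highest multiplicity among lengths in the length multiset of $n$, i.e. the maximum over $\ell$ of the number of factorizations of $n$ of length $\ell$; $\gamma(n)$ is the set of lengths $\ell$ attaining this multiplicity. Trade element: there is a unique minimal length-preserving trade $(a,0,c \mid 0,b,0)$, meaning $a,b,c\in\mathbb{N}$ with $b>0$ minimal such that $a+c=b$ and $an_1+cn_3=bn_2$; given a factorization of $n$ of length $\ell$, all other factorizations of $n$ of length $\ell$ are obtained from it by repeatedly performing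 this trade (in either direction). The trade element of $S$ is $t = an_1+cn_3 = bn_2$. The function $c_0$ only needs to be considered on $S$ (periodicity meaning $c_0(n+t)=c_0(n)$). *)

theory Defs
  imports Complex_Main "HOL-Library.Multiset"
begin

definition gen_semigroup :: "nat \<Rightarrow> nat \<Rightarrow> nat \<Rightarrow> nat set" where
  "gen_semigroup n1 n2 n3 = {a1 * n1 + a2 * n2 + a3 * n3 | a1 a2 a3. True}"

definition factorizations :: "nat \<Rightarrow> nat \<Rightarrow> nat \<Rightarrow> nat \<Rightarrow> (nat \<times> nat \<times> nat) set" where
  "factorizations n1 n2 n3 n = {(a1, a2, a3). n = a1 * n1 + a2 * n2 + a3 * n3}"

definition fact_length :: "nat \<times> nat \<times> nat \<Rightarrow> nat" where
  "fact_length = (\<lambda>(a1, a2, a3). a1 + a2 + a3)"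

(* For positive n1, n2, n3 the set of factorizations is finite, so mset_set does not
   collapse to the empty multiset. *)
definition length_multiset :: "nat \<Rightarrow> nat \<Rightarrow> nat \<Rightarrow> nat \<Rightarrow> nat multiset" where
  "length_multiset n1 n2 n3 n = image_mset fact_length (mset_set (factorizations n1 n2 n3 n))"

(* Meaningful for n in the semigroup: there the set under Max is finite and nonempty. *)
definition mode_frequency :: "nat \<Rightarrow> nat \<Rightarrow> nat \<Rightarrow> nat \<Rightarrow> nat" where
  "mode_frequency n1 n2 n3 n =
     (let L = length_multiset n1 n2 n3 n in Max (count L ` set_mset L))"

definition mode_lengths :: "nat \<Rightarrow> nat \<Rightarrow> nat \<Rightarrow> nat \<Rightarrow> nat set" where
  "mode_lengths n1 n2 n3 n =
     {l. l \<in># length_multiset n1 n2 n3 n \<and>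
        count (length_multiset n1 n2 n3 n) l = mode_frequency n1 n2 n3 n}"

(* The length-preserving trade (a,0,c | 0,b,0). *)
definition is_trade :: "nat \<Rightarrow> nat \<Rightarrow> nat \<Rightarrow> nat \<Rightarrow> nat \<Rightarrow> nat \<Rightarrow> bool" where
  "is_trade n1 n2 n3 a b c \<longleftrightarrow> 0 < b \<and> a + c = b \<and> a * n1 + c * n3 = b * n2"

(* For n1 < n2 < n3 a trade exists, e.g. (n3 - n2, 0, n2 - n1 | 0, n3 - n1, 0),
   so the least b is attained. *)
definition trade_element :: "nat \<Rightarrow> nat \<Rightarrow> nat \<Rightarrow> nat" where
  "trade_element n1 n2 n3 = (LEAST b. \<exists>a c. is_trade n1 n2 n3 a b c) * n2"

end

theory Submission
  imports Defs
begin

text \<open>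
  Let \<open>b\<close> be the size of the minimal trade, so \<open>t = b n2\<close>. Adding \<open>b\<close> copies of \<open>n2\<close> injects the
  factorizations of \<open>n\<close> of length \<open>l\<close> into those of \<open>n + t\<close> of length \<open>l + b\<close>, and misses exactly
  those using fewer than \<open>b\<close> copies of \<open>n2\<close>. Minimality of \<open>b\<close> leaves at most one of these in each
  length, and trading down produces one as soon as \<open>l\<close> is a length of \<open>n\<close>. Hence every length of
  \<open>n\<close>, shifted by \<open>b\<close>, gains exactly one factorization, while every other length of \<open>n + t\<close> occurs
  only once and so cannot be a mode.
\<close>

section \<open>Factorizations of a fixed length\<close>

definition factorizations_of_length :: "nat \<Rightarrow> nat \<Rightarrow> nat \<Rightarrow> nat \<Rightarrow> nat \<Rightarrow> (nat \<times> nat \<times> nat) set" where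
  "factorizations_of_length n1 n2 n3 n l = {p \<in> factorizations n1 n2 n3 n. fact_length p = l}"

lemma mem_factorizations_of_length [simp]:
  "(x, y, z) \<in> factorizations_of_length n1 n2 n3 n l \<longleftrightarrow>
     n = x * n1 + y * n2 + z * n3 \<and> x + y + z = l"
  by (auto simp: factorizations_of_length_def factorizations_def fact_length_def)

lemma finite_factorizations:
  assumes "0 < n1" "0 < n2" "0 < n3"
  shows "finite (factorizations n1 n2 n3 n)"
proof (rule finite_subset)
  have "x \<le> x * n1 + y * n2 + z * n3 \<and> y \<le> x * n1 + y * n2 + z * n3 \<and> z \<le> x * n1 + y * n2 + z * n3"
    for x y z :: nat
  proof -
    have "x \<le> x * n1" "y \<le> y * n2" "z \<le> z * n3" using assms by simp_all
    then show ?thesis by linarith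
  qed
  then show "factorizations n1 n2 n3 n \<subseteq> {..n} \<times> {..n} \<times> {..n}"
    by (auto simp: factorizations_def)
qed auto

lemma finite_factorizations_of_length:
  "finite (factorizations_of_length n1 n2 n3 n l)"
proof (rule finite_subset)
  show "factorizations_of_length n1 n2 n3 n l \<subseteq> {..l} \<times> {..l} \<times> {..l}"
    by auto
qed auto

text \<open>Turns multiplicities into cardinalities of sets of factorizations, on which trades and
  shifts act directly.\<close>

lemma count_length_multiset:
  assumes "0 < n1" "0 < n2" "0 < n3"
  shows "count (length_multiset n1 n2 n3 n) l = card (factorizations_of_length n1 n2 n3 n l)"
proof -
  have "fact_length -` {l} \<inter> factorizations n1 n2 n3 n = factorizations_of_length n1 n2 n3 n l"
    by (auto simp: factorizations_of_length_def)
  then have "count (length_multiset n1 n2 n3 n) l =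
      (\<Sum>p\<in>factorizations_of_length n1 n2 n3 n l. count (mset_set (factorizations n1 n2 n3 n)) p)"
    using finite_factorizations[OF assms, of n]
    by (simp add: length_multiset_def count_image_mset)
  also have "\<dots> = (\<Sum>p\<in>factorizations_of_length n1 n2 n3 n l. 1)"
    using finite_factorizations[OF assms, of n]
    by (intro sum.cong) (auto simp: factorizations_of_length_def)
  finally show ?thesis by simp
qed

lemma length_multiset_nonempty:
  assumes "0 < n1" "0 < n2" "0 < n3" and "n \<in> gen_semigroup n1 n2 n3"
  shows "length_multiset n1 n2 n3 n \<noteq> {#}"
proof -
  have "factorizations n1 n2 n3 n \<noteq> {}"
    using assms(4) by (auto simp: gen_semigroup_def factorizations_def)
  then show ?thesis
    using finite_factorizations[OF assms(1-3), of n]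
    by (simp add: length_multiset_def mset_set_empty_iff)
qed

section \<open>The minimal trade\<close>

lemma exists_minimal_trade:
  assumes "n1 < n2" "n2 < n3"
  obtains a b c where "is_trade n1 n2 n3 a b c"
    and "\<And>a' b' c'. is_trade n1 n2 n3 a' b' c' \<Longrightarrow> b \<le> b'"
    and "trade_element n1 n2 n3 = b * n2"
proof -
  let ?P = "\<lambda>b. \<exists>a c. is_trade n1 n2 n3 a b c"
  define d e where "d = n2 - n1" and "e = n3 - n2"
  have n: "n2 = n1 + d" "n3 = n1 + d + e" "0 < d"
    using assms by (auto simp: d_def e_def)
  \<comment> \<open>\<open>n2\<close> is the average of \<open>n1\<close> and \<open>n3\<close> with
    weights \<open>e\<close> and \<open>d\<close>; clearing the denominator \<open>d + e\<close>
    gives a trade.\<close>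
  have "is_trade n1 n2 n3 e (d + e) d"
    unfolding is_trade_def n(1,2) using n(3) by (simp add: algebra_simps)
  then have "?P (LEAST b. ?P b)"
    by (intro LeastI[of ?P]) blast
  then show thesis
    using that by (metis (no_types, lifting) Least_le trade_element_def)
qed

text \<open>Two factorizations of equal value and length whose middle coordinates differ by
  \<open>k > 0\<close> yield a trade of size \<open>k\<close>. If both coordinates are below
  \<open>b\<close>, then \<open>k < b\<close>, against minimality. If they agree,
  \<open>n1 < n3\<close> forces the outer coordinates to agree too.\<close>

lemma card_low_factorizations_le_1:
  assumes "n1 < n2" "n2 < n3"
    and min: "\<And>a' b' c'. is_trade n1 n2 n3 a' b' c' \<Longrightarrow> b \<le> b'"
  shows "card {p \<in> factorizations_of_length n1 n2 n3 n l. fst (snd p) < b} \<le> 1"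
proof -
  have no_less: False
    if eq: "x * n1 + y * n2 + z * n3 = x' * n1 + y' * n2 + z' * n3" "x + y + z = x' + y' + z'"
      and less: "y < y'" "y' < b" for x y z x' y' z'
  proof -
    define d where "d = n2 - n1"
    define e where "e = n3 - n2"
    have n: "n2 = n1 + d" "n3 = n1 + d + e" "0 < d" "0 < e"
      using assms by (auto simp: d_def e_def)
    \<comment> \<open>Since the lengths are equal, the multiples of \<open>n1\<close> cancel and
      only the offsets \<open>d\<close> and \<open>d + e\<close> from \<open>n1\<close>
      remain.\<close>
    have "x * n1 + y * n2 + z * n3 = (x + y + z) * n1 + y * d + z * (d + e)"
      "x' * n1 + y' * n2 + z' * n3 = (x' + y' + z') * n1 + y' * d + z' * (d + e)"
      by (simp_all add: n algebra_simps)
    with eq have zd: "y * d + z * (d + e) = y' * d + z' * (d + e)"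
      by simp
    obtain k where k: "y' = y + k" "0 < k"
      using less by (metis less_imp_add_positive)
    have z: "z * (d + e) = z' * (d + e) + k * d"
      using zd by (simp add: k algebra_simps)
    then have "z' * (d + e) \<le> z * (d + e)" by simp
    then have "z' \<le> z" using n by simp
    then obtain w where w: "z = z' + w" using le_Suc_ex by blast
    have wk: "w * (d + e) = k * d" using z by (simp add: w algebra_simps)
    \<comment> \<open>This bound makes \<open>u = k - w\<close> a natural number, so that giving up
      \<open>k\<close> copies of \<open>n2\<close> for \<open>u\<close> of \<open>n1\<close> and
      \<open>w\<close> of \<open>n3\<close> is a genuine trade.\<close>
    then have "w * d \<le> k * d" by (simp add: distrib_left flip: wk)
    then have "w \<le> k" using n by simp
    then obtain u where u: "k = u + w" using le_Suc_ex by (metis add.commute)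
    have "u * n1 + w * n3 = (u + w) * n1 + w * (d + e)"
      by (simp add: n algebra_simps)
    also have "\<dots> = k * n2" unfolding wk u[symmetric] by (simp add: n(1) distrib_left)
    finally have "is_trade n1 n2 n3 u k w"
      using k u by (simp add: is_trade_def)
    then show False using min less k by fastforce
  qed
  have same: "x = x' \<and> z = z'"
    if eq: "x * n1 + y * n2 + z * n3 = x' * n1 + y * n2 + z' * n3" "x + y + z = x' + y + z'"
    for x y z x' z'
  proof -
    obtain d where n: "n3 = n1 + d" "0 < d"
      using assms less_imp_add_positive[of n1 n3] by auto
    have "x * n1 + z * n3 = (x + z) * n1 + z * d"
      "x' * n1 + z' * n3 = (x' + z') * n1 + z' * d"
      by (simp_all add: n algebra_simps)
    then show ?thesis using eq n by simp
  qed
  have "p = q" if "p \<in> factorizations_of_length n1 n2 n3 n l" "fst (snd p) < b"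
    "q \<in> factorizations_of_length n1 n2 n3 n l" "fst (snd q) < b" for p q
  proof -
    obtain x y z x' y' z' where pq: "p = (x, y, z)" "q = (x', y', z')"
      by (metis prod_cases3)
    have eq: "x * n1 + y * n2 + z * n3 = x' * n1 + y' * n2 + z' * n3" "x + y + z = x' + y' + z'"
      and lt: "y < b" "y' < b"
      using that by (simp_all add: pq)
    have "y = y'"
      using no_less[OF eq _ lt(2)] no_less[OF eq[symmetric] _ lt(1)] by (meson linorder_neqE_nat)
    then show ?thesis using same eq pq by blast
  qed
  then show ?thesis
    using finite_factorizations_of_length[of n1 n2 n3 n l] by (simp add: card_le_Suc0_iff_eq)
qed

text \<open>Trading away \<open>n2\<close> in blocks of \<open>b\<close>, as often as possible,
  leaves \<open>y mod b\<close> copies of it and preserves value and length.\<close>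

lemma low_factorization_exists:
  assumes "is_trade n1 n2 n3 a b c" and "p \<in> factorizations_of_length n1 n2 n3 n l"
  shows "\<exists>q \<in> factorizations_of_length n1 n2 n3 n l. fst (snd q) < b"
proof -
  obtain x y z where p: "p = (x, y, z)" by (metis prod_cases3)
  define k where "k = y div b"
  define r where "r = y mod b"
  have y: "y = k * b + r" by (simp add: k_def r_def)
  have t: "0 < b" "a + c = b" "a * n1 + c * n3 = b * n2"
    using assms(1) by (auto simp: is_trade_def)
  have "k * a * n1 + k * c * n3 = k * b * n2" "k * a + k * c = k * b"
    using arg_cong[OF t(3), of "(*) k"] arg_cong[OF t(2), of "(*) k"]
    by (simp_all add: distrib_left mult.assoc)
  then have "(x + k * a, r, z + k * c) \<in> factorizations_of_length n1 n2 n3 n l"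
    using assms(2) by (simp add: p y add_mult_distrib)
  moreover have "r < b" using t by (simp add: r_def)
  ultimately show ?thesis by (intro bexI[of _ "(x + k * a, r, z + k * c)"]) simp_all
qed

section \<open>The effect of adding \<open>b\<close> copies of \<open>n2\<close>\<close>

lemma high_factorizations_eq_image:
  "{p \<in> factorizations_of_length n1 n2 n3 (n + b * n2) (l + b). b \<le> fst (snd p)} =
     (\<lambda>(x, y, z). (x, y + b, z)) ` factorizations_of_length n1 n2 n3 n l" (is "?L = ?f ` ?R")
proof
  show "?L \<subseteq> ?f ` ?R"
  proof
    fix p assume "p \<in> ?L"
    moreover obtain x y z where p: "p = (x, y, z)" by (metis prod_cases3)
    ultimately obtain y' where "y = y' + b"
      using le_Suc_ex by (metis (no_types, lifting) add.commute fst_conv mem_Collect_eq snd_conv)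
    with \<open>p \<in> ?L\<close> have "(x, y', z) \<in> ?R" "p = ?f (x, y', z)"
      by (simp_all add: p add_mult_distrib)
    then show "p \<in> ?f ` ?R" by blast
  qed
  show "?f ` ?R \<subseteq> ?L" by (auto simp: add_mult_distrib)
qed

text \<open>The factorizations with at least \<open>b\<close> copies of \<open>n2\<close> are the
  injective image of those of \<open>n\<close>; the others form the last summand.\<close>

lemma card_factorizations_of_length_shift:
  "card (factorizations_of_length n1 n2 n3 (n + b * n2) (l + b)) =
     card (factorizations_of_length n1 n2 n3 n l) +
     card {p \<in> factorizations_of_length n1 n2 n3 (n + b * n2) (l + b). fst (snd p) < b}"
proof -
  let ?F = "factorizations_of_length n1 n2 n3 (n + b * n2) (l + b)"
  have "?F = {p \<in> ?F. b \<le> fst (snd p)} \<union> {p \<in> ?F. fst (snd p) < b}" by auto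
  then have "card ?F = card {p \<in> ?F. b \<le> fst (snd p)} + card {p \<in> ?F. fst (snd p) < b}"
    using finite_factorizations_of_length[of n1 n2 n3 "n + b * n2" "l + b"]
    by (subst card_Un_disjoint[symmetric]) auto
  moreover have "inj_on (\<lambda>(x, y, z). (x, y + b, z)) (factorizations_of_length n1 n2 n3 n l)"
    by (auto simp: inj_on_def)
  ultimately show ?thesis
    by (simp add: high_factorizations_eq_image card_image)
qed

text \<open>The step from counts to modes, free of semigroups. The maximum over the shifted entries
  of \<open>L\<close> rises by one, to at least 2, so entries of multiplicity at most 1 can neither
  exceed nor attain it.\<close>

lemma Max_count_shift:
  fixes L L' :: "nat multiset"
  assumes ne: "L \<noteq> {#}"
    and shift: "\<And>l. l \<in># L \<Longrightarrow> count L' (l + b) = Suc (count L l)"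
    and other: "\<And>l'. \<not> (\<exists>l. l \<in># L \<and> l' = l + b) \<Longrightarrow> count L' l' \<le> 1"
  shows "Max (count L' ` set_mset L') = Suc (Max (count L ` set_mset L))" (is "?M' = Suc ?M")
    and "{l. l \<in># L' \<and> count L' l = Max (count L' ` set_mset L')} =
         {m + b | m. m \<in># L \<and> count L m = Max (count L ` set_mset L)}"
proof -
  have le: "count L l \<le> ?M" if "l \<in># L" for l using that by simp
  have "?M \<in> count L ` set_mset L" using ne by (intro Max_in) auto
  then obtain m where m: "m \<in># L" "count L m = ?M" by auto
  have pos: "0 < ?M" using m by (metis count_greater_zero_iff)
  have memI: "l + b \<in># L'" if "l \<in># L" for l
    using shift[OF that] by (metis count_greater_zero_iff zero_less_Suc)
  show eq: "?M' = Suc ?M"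
  proof (rule Max_eqI)
    fix k assume "k \<in> count L' ` set_mset L'"
    then obtain l' where k: "k = count L' l'" by auto
    show "k \<le> Suc ?M"
    proof (cases "\<exists>l. l \<in># L \<and> l' = l + b")
      case True
      then show ?thesis using k shift le by auto
    next
      case False
      then show ?thesis using other[of l'] k by simp
    qed
  next
    show "Suc ?M \<in> count L' ` set_mset L'"
      using shift[OF m(1)] m memI[OF m(1)] by (metis imageI)
  qed simp
  show "{l. l \<in># L' \<and> count L' l = ?M'} = {m + b | m. m \<in># L \<and> count L m = ?M}"
  proof (intro equalityI subsetI)
    fix l' assume "l' \<in> {l. l \<in># L' \<and> count L' l = ?M'}"
    then have c: "count L' l' = Suc ?M" by (simp add: eq)
    then have "\<not> count L' l' \<le> 1" using pos by simp
    then obtain l where "l \<in># L" "l' = l + b" using other by blast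
    then show "l' \<in> {m + b | m. m \<in># L \<and> count L m = ?M}"
      using c shift by auto
  next
    fix l' assume "l' \<in> {m + b | m. m \<in># L \<and> count L m = ?M}"
    then show "l' \<in> {l. l \<in># L' \<and> count L' l = ?M'}"
      using shift memI by (auto simp: eq)
  qed
qed

lemma mode_shift:
  assumes "0 < n1" "n1 < n2" "n2 < n3" and "n \<in> gen_semigroup n1 n2 n3"
    and trade: "is_trade n1 n2 n3 a b c"
    and min: "\<And>a' b' c'. is_trade n1 n2 n3 a' b' c' \<Longrightarrow> b \<le> b'"
  shows "mode_frequency n1 n2 n3 (n + b * n2) = Suc (mode_frequency n1 n2 n3 n)"
    and "mode_lengths n1 n2 n3 (n + b * n2) = {m + b | m. m \<in> mode_lengths n1 n2 n3 n}"
proof -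
  have pos: "0 < n1" "0 < n2" "0 < n3" using assms(1-3) by auto
  let ?F = "factorizations_of_length n1 n2 n3"
  let ?low = "\<lambda>l. {p \<in> ?F (n + b * n2) l. fst (snd p) < b}"
  let ?L = "length_multiset n1 n2 n3"
  note count = count_length_multiset[OF pos]
  have mem: "l \<in># ?L n \<longleftrightarrow> ?F n l \<noteq> {}" for l
    using finite_factorizations_of_length[of n1 n2 n3 n l]
    by (simp add: count card_gt_0_iff flip: count_greater_zero_iff)
  have low1: "card (?low l) \<le> 1" for l
    using assms(2,3) min by (rule card_low_factorizations_le_1)
  have shift: "count (?L (n + b * n2)) (l + b) = Suc (count (?L n) l)" if l: "l \<in># ?L n" for l
  proof -
    obtain p where "p \<in> ?F n l" using l mem[of l] by blast
    moreover obtain x y z where "p = (x, y, z)" by (metis prod_cases3)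
    ultimately have "(x, y, z) \<in> ?F n l" by simp
    then have "(x, y + b, z) \<in> ?F (n + b * n2) (l + b)"
      by (simp add: add_mult_distrib)
    \<comment> \<open>The trade is applied to the shifted factorization of
      \<open>n + b * n2\<close>; with \<open>low1\<close>, exactly one low factorization
      results.\<close>
    from low_factorization_exists[OF trade this] have "?low (l + b) \<noteq> {}" by blast
    then have "card (?low (l + b)) \<noteq> 0"
      using finite_factorizations_of_length[of n1 n2 n3 "n + b * n2" "l + b"] by simp
    then have "card (?low (l + b)) = 1"
      using low1[of "l + b"] by linarith
    then show ?thesis
      by (simp add: count card_factorizations_of_length_shift)
  qed
  have other: "count (?L (n + b * n2)) l' \<le> 1" if no: "\<not> (\<exists>l. l \<in># ?L n \<and> l' = l + b)" for l'
  proof (cases "b \<le> l'")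
    case True
    then obtain l where l: "l' = l + b" by (metis le_add_diff_inverse2)
    with no have "\<not> l \<in># ?L n" by simp
    then have "?F n l = {}" using mem[of l] by simp
    \<comment> \<open>With no factorization of \<open>n\<close> of length \<open>l\<close> to shift,
      only the low ones are counted.\<close>
    then show ?thesis
      using low1[of l'] by (simp add: count l card_factorizations_of_length_shift)
  next
    case False
    \<comment> \<open>A length below \<open>b\<close> leaves room for fewer than \<open>b\<close>
      copies of \<open>n2\<close>.\<close>
    then have "?low l' = ?F (n + b * n2) l'" by auto
    then show ?thesis using low1[of l'] by (simp add: count)
  qed
  note nonempty = length_multiset_nonempty[OF pos assms(4)]
  show "mode_frequency n1 n2 n3 (n + b * n2) = Suc (mode_frequency n1 n2 n3 n)"
    unfolding mode_frequency_def Let_def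
    using nonempty shift other by (rule Max_count_shift(1))
  have "{l. l \<in># ?L (n + b * n2) \<and> count (?L (n + b * n2)) l =
          Max (count (?L (n + b * n2)) ` set_mset (?L (n + b * n2)))} =
        {m + b | m. m \<in># ?L n \<and> count (?L n) m = Max (count (?L n) ` set_mset (?L n))}"
    using nonempty shift other by (rule Max_count_shift(2))
  then show "mode_lengths n1 n2 n3 (n + b * n2) = {m + b | m. m \<in> mode_lengths n1 n2 n3 n}"
    by (simp add: mode_lengths_def mode_frequency_def Let_def)
qed

theorem theorem5:
  fixes n1 n2 n3 t :: nat and S :: "nat set"
  assumes "0 < n1" and "n1 < n2" and "n2 < n3"
    and "gcd n1 (gcd n2 n3) = 1"
  defines "S \<equiv> gen_semigroup n1 n2 n3"
    and "t \<equiv> trade_element n1 n2 n3"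
  shows "(\<exists>c0 :: nat \<Rightarrow> rat.
            (\<forall>n\<in>S. c0 (n + t) = c0 n) \<and>
            (\<forall>n\<in>S. of_nat (mode_frequency n1 n2 n3 n) = 1 / of_nat t * of_nat n + c0 n)) \<and>
         (\<forall>n\<in>S. mode_lengths n1 n2 n3 (n + t)
                  = {m + t div n2 | m. m \<in> mode_lengths n1 n2 n3 n})"
proof -
  obtain a b c where trade: "is_trade n1 n2 n3 a b c"
    and min: "\<And>a' b' c'. is_trade n1 n2 n3 a' b' c' \<Longrightarrow> b \<le> b'"
    and t: "t = b * n2"
    using exists_minimal_trade[OF assms(2,3)] t_def by metis
  have t_pos: "0 < t" and t_div: "t div n2 = b"
    using trade assms(2) by (auto simp: t is_trade_def)
  have shift: "mode_frequency n1 n2 n3 (n + t) = Suc (mode_frequency n1 n2 n3 n)"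
    "mode_lengths n1 n2 n3 (n + t) = {m + b | m. m \<in> mode_lengths n1 n2 n3 n}" if "n \<in> S" for n
    unfolding t by (rule mode_shift[OF assms(1-3) that[unfolded S_def] trade], erule min)+
  \<comment> \<open>Taking \<open>c0\<close> as the difference makes the formula immediate. The
    content is periodicity: passing from \<open>n\<close> to \<open>n + t\<close> raises both the
    mode frequency and \<open>n / t\<close> by one.\<close>
  define c0 :: "nat \<Rightarrow> rat" where
    "c0 n = of_nat (mode_frequency n1 n2 n3 n) - 1 / of_nat t * of_nat n" for n
  have "c0 (n + t) = c0 n" if "n \<in> S" for n
    using shift(1)[OF that] t_pos by (simp add: c0_def field_simps)
  moreover have "of_nat (mode_frequency n1 n2 n3 n) = 1 / of_nat t * of_nat n + c0 n" for n
    by (simp add: c0_def)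
  ultimately show ?thesis
    using shift(2) unfolding t_div by blast
qed

end
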